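(* Let $\Lambda_0$ be a collection of subsets of $[n]$. Given a statistic $\theta=\sum_{\lambda\in\Lambda_0}h_\lambda(x_\lambda)$, where each $h_\lambda$ is a real-valued function, the pseudo-Horvitz-Thompson estimator using the recalibrated inclusion indicators $\tilde Z$ and recalibrated thresholds $\tilde T$, $$\hat\theta(\tilde Z,\tilde T)=\sum_{\lambda\in\Lambda_0}h_\lambda(x_\lambda)\prod_{i\in\lambda}\frac{\tilde Z^\lambda_i}{F_i(\tilde T^\lambda_i)},$$ is an unbiased estimator for $\theta$, i.e. $\mathbb E\,\hat\theta(\tilde Z,\tilde T)=\theta$.
   Context: Data: fixed items $x_1,\dots,x_n$, $[n]=\{1,\dots,n\}$. Each item $x_i$ has a random priority $R_i$; the priorities $R_1,\dots,R_n$ are independent and $R_i$ is continuous with CDF $F_i$. An adaptive thresholding rule is a function $\tau=(\tau_1,\dots,\tau_n)$ of the priority vector $\mathbf R=(R_1,\dots,R_n)$ (it may also depend on the fixed data), and the threshold is $T_i=\tau_i(\mathbf R)$. For $\lambda\subseteq[n]$, a subscript $\lambda$ selects the coordinates in $\lambda$ (so $x_\lambda=(x_i)_{i\in\lambda}$), and $R_{-\lambda}$ is the vector of priorities with indices not in $\lambda$. The recalibrated thresholding rule and threshold with respect to $\lambda$ are $$\tilde\tau^\lambda_i(R_{-\lambda})=\inf_r\{\tau_i(r): r_{-\lambda}=R_{-\lambda}\},\qquad \tilde T^\lambda_i=\tilde\tau^\lambda_i(R_{-\lambda}),\quad i\in[n],$$ where $r$ ranges over all possible priority vectors. The recalibrated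 inclusion indicators are $\tilde Z^\lambda_i=1(R_i<\tilde T^\lambda_i)$.
   Formalization: The formal theorem adds that F_i of each recalibrated threshold is positive almost surely for i in λ (otherwise the estimator is 0/0 and the claim fails), and that the recalibrated rules are measurable for the completed law of R_{-λ}, so that the expectation makes sense. *)

theory Defs
  imports "HOL-Probability.Probability"
begin

text \<open>
  Priority vectors indexed by a set \<open>I\<close> of naturals are the extensional functions in
  \<open>I \<rightarrow>\<^sub>E UNIV\<close>, so that \<open>restrict r J\<close> is the subvector of \<open>r\<close> with coordinates in \<open>J\<close>.
  The set of all possible priority vectors is a parameter \<open>V\<close>; it may for instance be all of
  \<open>{1..n} \<rightarrow>\<^sub>E UNIV\<close>, or a product of supports.

  Thresholds are extended reals: an infimum of thresholds may be \<open>-\<infinity>\<close>, and a rule that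
  imposes no restriction has threshold \<open>\<infinity>\<close>. Real-valued rules are included via \<open>ereal\<close>.
\<close>

definition recalibrated_rule ::
  "nat \<Rightarrow> (nat \<Rightarrow> real) set \<Rightarrow> (nat \<Rightarrow> (nat \<Rightarrow> real) \<Rightarrow> ereal)
    \<Rightarrow> nat set \<Rightarrow> nat \<Rightarrow> (nat \<Rightarrow> real) \<Rightarrow> ereal" where
  "recalibrated_rule n V \<tau> L i s =
     (INF r \<in> {r \<in> V. restrict r ({1..n} - L) = s}. \<tau> i r)"

definition recalibrated_threshold ::
  "nat \<Rightarrow> (nat \<Rightarrow> real) set \<Rightarrow> (nat \<Rightarrow> (nat \<Rightarrow> real) \<Rightarrow> ereal)
    \<Rightarrow> (nat \<Rightarrow> 'w \<Rightarrow> real) \<Rightarrow> 'w \<Rightarrow> nat set \<Rightarrow> nat \<Rightarrow> ereal" where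
  "recalibrated_threshold n V \<tau> R \<omega> L i =
     recalibrated_rule n V \<tau> L i (\<lambda>j\<in>{1..n} - L. R j \<omega>)"

definition recalibrated_indicator ::
  "nat \<Rightarrow> (nat \<Rightarrow> real) set \<Rightarrow> (nat \<Rightarrow> (nat \<Rightarrow> real) \<Rightarrow> ereal)
    \<Rightarrow> (nat \<Rightarrow> 'w \<Rightarrow> real) \<Rightarrow> 'w \<Rightarrow> nat set \<Rightarrow> nat \<Rightarrow> real" where
  "recalibrated_indicator n V \<tau> R \<omega> L i =
     of_bool (ereal (R i \<omega>) < recalibrated_threshold n V \<tau> R \<omega> L i)"

text \<open>A CDF extended to infinite arguments by its limits.\<close>

definition ext_cdf :: "(real \<Rightarrow> real) \<Rightarrow> ereal \<Rightarrow> real" where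
  "ext_cdf F t = (case t of ereal r \<Rightarrow> F r | PInfty \<Rightarrow> 1 | MInfty \<Rightarrow> 0)"

definition statistic ::
  "nat set set \<Rightarrow> (nat set \<Rightarrow> (nat \<Rightarrow> 'x) \<Rightarrow> real) \<Rightarrow> (nat \<Rightarrow> 'x) \<Rightarrow> real" where
  "statistic \<Lambda> h x = (\<Sum>L\<in>\<Lambda>. h L (restrict x L))"

definition pseudo_HT ::
  "nat set set \<Rightarrow> (nat set \<Rightarrow> (nat \<Rightarrow> 'x) \<Rightarrow> real) \<Rightarrow> (nat \<Rightarrow> 'x) \<Rightarrow> (nat \<Rightarrow> real \<Rightarrow> real)
    \<Rightarrow> (nat set \<Rightarrow> nat \<Rightarrow> real) \<Rightarrow> (nat set \<Rightarrow> nat \<Rightarrow> ereal) \<Rightarrow> real" where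
  "pseudo_HT \<Lambda> h x F Z T =
     (\<Sum>L\<in>\<Lambda>. h L (restrict x L) * (\<Prod>i\<in>L. Z L i / ext_cdf (F i) (T L i)))"

definition recalibrated_pseudo_HT ::
  "nat \<Rightarrow> (nat \<Rightarrow> real) set \<Rightarrow> (nat \<Rightarrow> (nat \<Rightarrow> real) \<Rightarrow> ereal) \<Rightarrow> (nat \<Rightarrow> 'w \<Rightarrow> real)
    \<Rightarrow> nat set set \<Rightarrow> (nat set \<Rightarrow> (nat \<Rightarrow> 'x) \<Rightarrow> real) \<Rightarrow> (nat \<Rightarrow> 'x)
    \<Rightarrow> (nat \<Rightarrow> real \<Rightarrow> real) \<Rightarrow> 'w \<Rightarrow> real" where
  "recalibrated_pseudo_HT n V \<tau> R \<Lambda> h x F \<omega> =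
     pseudo_HT \<Lambda> h x F
       (recalibrated_indicator n V \<tau> R \<omega>) (recalibrated_threshold n V \<tau> R \<omega>)"

text \<open>
  Even for Borel \<open>\<tau>\<close> and \<open>V\<close>, the recalibrated rule is an infimum over an uncountable set and
  need not be Borel; its sublevel sets are projections of Borel sets, hence analytic, hence
  measurable for the completion of every law. The following predicate therefore asks for
  measurability with respect to the completed law of the remaining priorities, and
  expectations of functions of the recalibrated thresholds are taken over \<open>completion M\<close>
  (integrals of \<open>M\<close>-measurable functions are the same over \<open>M\<close> and \<open>completion M\<close>).
\<close>

definition recalibrated_rule_measurable ::
  "'w measure \<Rightarrow> nat \<Rightarrow> (nat \<Rightarrow> real) set \<Rightarrow> (nat \<Rightarrow> (nat \<Rightarrow> real) \<Rightarrow> ereal)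
    \<Rightarrow> (nat \<Rightarrow> 'w \<Rightarrow> real) \<Rightarrow> nat set \<Rightarrow> nat \<Rightarrow> bool" where
  "recalibrated_rule_measurable M n V \<tau> R L i \<longleftrightarrow>
     recalibrated_rule n V \<tau> L i \<in> borel_measurable
       (completion (distr M (Pi\<^sub>M ({1..n} - L) (\<lambda>_. borel)) (\<lambda>\<omega>. \<lambda>j\<in>{1..n} - L. R j \<omega>)))"

end

theory Submission
  imports Defs
begin

text \<open>
  Conditionally on the priorities outside \<open>L\<close>, the recalibrated thresholds are constants \<open>t\<^sub>i\<close>,
  while the priorities in \<open>L\<close> keep their independent laws. The conditional expectation of the
  product over \<open>L\<close> therefore factorises into the terms \<open>P(R\<^sub>i < t\<^sub>i) / F\<^sub>i(t\<^sub>i)\<close>, each of which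
  is \<open>1\<close> because \<open>F\<^sub>i\<close> is continuous.
\<close>

text \<open>Preimages under \<open>f\<close> and \<open>g\<close> differ only inside a null set, and
  the completion contains every subset of a null set.\<close>

lemma AE_eq_borel_measurable_completion:
  fixes f g :: "'a \<Rightarrow> 'b::topological_space"
  assumes g: "g \<in> borel_measurable M" and eq: "AE x in M. f x = g x"
  shows "f \<in> borel_measurable (completion M)"
proof (rule measurableI)
  fix A :: "'b set" assume "A \<in> sets borel"
  then have sets: "g -` A \<inter> space (completion M) \<in> sets (completion M)"
    using measurable_sets[OF measurable_completion[OF g]] by simp
  have "AE x in completion M.
      x \<in> g -` A \<inter> space (completion M) \<longleftrightarrow> x \<in> f -` A \<inter> space (completion M)"
    using AE_completion[OF eq] by eventually_elim auto
  then show "f -` A \<inter> space (completion M) \<in> sets (completion M)"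
    by (rule completion.in_sets_AE[OF _ sets]) auto
qed simp

text \<open>An extended real is recovered from its positive and negative parts, which take values in
  \<open>ennreal\<close>, where the corresponding fact is in the library.\<close>

lemma completion_ex_borel_measurable_ereal:
  fixes g :: "'a \<Rightarrow> ereal"
  assumes [measurable]: "g \<in> borel_measurable (completion M)"
  shows "\<exists>g'\<in>borel_measurable M. AE x in M. g x = g' x"
proof -
  have "(\<lambda>x. e2ennreal (g x)) \<in> borel_measurable (completion M)"
    by measurable
  from completion_ex_borel_measurable[OF this] obtain p
    where [measurable]: "p \<in> borel_measurable M" and p: "AE x in M. e2ennreal (g x) = p x"
    by blast
  have "(\<lambda>x. e2ennreal (- g x)) \<in> borel_measurable (completion M)"
    by measurable
  from completion_ex_borel_measurable[OF this] obtain q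
    where [measurable]: "q \<in> borel_measurable M" and q: "AE x in M. e2ennreal (- g x) = q x"
    by blast
  have "AE x in M. g x = enn2ereal (p x) - enn2ereal (q x)"
    using p q
  proof eventually_elim
    case (elim x)
    \<comment> \<open>\<open>e2ennreal\<close> sends negative values to 0, so at each point at least
      one of the two parts vanishes and the difference is never infinity minus infinity.\<close>
    have "g x = enn2ereal (e2ennreal (g x)) - enn2ereal (e2ennreal (- g x))"
    proof (cases "0 \<le> g x")
      case True
      then have "e2ennreal (- g x) = 0"
        by (intro e2ennreal_neg) simp
      with True show ?thesis
        by (simp add: enn2ereal_e2ennreal zero_ennreal.rep_eq)
    next
      case False
      then have "e2ennreal (g x) = 0" "0 \<le> - g x"
        by (auto intro: e2ennreal_neg)
      then show ?thesis
        by (simp add: enn2ereal_e2ennreal zero_ennreal.rep_eq)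
    qed
    then show ?case by (simp only: elim)
  qed
  moreover have "(\<lambda>x. enn2ereal (p x) - enn2ereal (q x)) \<in> borel_measurable M"
    by measurable
  ultimately show ?thesis by (rule bexI)
qed

lemma borel_measurable_ext_cdf:
  assumes [measurable]: "F \<in> borel_measurable borel"
  shows "ext_cdf F \<in> borel_measurable borel"
proof -
  \<comment> \<open>With the two infinite points split off, only the measurability of
    \<open>F\<close> composed with \<open>real_of_ereal\<close> remains.\<close>
  have "ext_cdf F = (\<lambda>t. if t = \<infinity> then 1 else if t = - \<infinity> then 0 else F (real_of_ereal t))"
    by (auto simp: ext_cdf_def fun_eq_iff split: ereal.split)
  also have "\<dots> \<in> borel_measurable borel"
    by measurable
  finally show ?thesis .
qed

lemma (in real_distribution) ext_cdf_nonneg: "0 \<le> ext_cdf (cdf M) t"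
  by (cases t) (simp_all add: ext_cdf_def cdf_nonneg)

text \<open>A CDF measures closed half-lines while inclusion is a strict inequality; continuity
  removes the atom at the threshold. For infinite \<open>t\<close> the event is empty or everything,
  which matches the limiting values in \<open>ext_cdf\<close>.\<close>

lemma (in real_distribution) emeasure_less_eq_ext_cdf:
  assumes "continuous_on UNIV (cdf M)"
  shows "emeasure M {r. ereal r < t} = ennreal (ext_cdf (cdf M) t)"
proof (cases t)
  case (real a)
  have "{..a} = insert a {..<a}" by auto
  then have "cdf M a = measure M {..<a} + measure M {a}"
    unfolding cdf_def using finite_measure_Union[of "{..<a}" "{a}"] by simp
  moreover have "measure M {a} = 0"
    using assms isCont_cdf[of a] by (simp add: continuous_on_eq_continuous_at)
  moreover have "{r. ereal r < t} = {..<a}"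
    using real by auto
  ultimately show ?thesis
    using real by (simp add: ext_cdf_def emeasure_eq_measure)
next
  case PInf
  then show ?thesis
    using emeasure_space_1 by (simp add: ext_cdf_def)
next
  case MInf
  then show ?thesis by (simp add: ext_cdf_def)
qed

text \<open>The numerator integrates to exactly the probability it is divided by. Positivity
  excludes 0/0, which evaluates to 0 and would make the integral 0.\<close>

lemma (in real_distribution) nn_integral_inverse_probability_weight:
  assumes "continuous_on UNIV (cdf M)" and "0 < ext_cdf (cdf M) t"
  shows "(\<integral>\<^sup>+r. ennreal (of_bool (ereal r < t) / ext_cdf (cdf M) t) \<partial>M) = 1"
proof -
  let ?c = "ext_cdf (cdf M) t"
  have "(\<integral>\<^sup>+r. ennreal (of_bool (ereal r < t) / ?c) \<partial>M)
      = (\<integral>\<^sup>+r. ennreal (1 / ?c) * indicator {r. ereal r < t} r \<partial>M)"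
    by (intro nn_integral_cong) (auto simp: indicator_def)
  also have "\<dots> = ennreal (1 / ?c) * emeasure M {r. ereal r < t}"
    by (intro nn_integral_cmult_indicator) simp
  also have "\<dots> = 1"
    using assms by (simp add: emeasure_less_eq_ext_cdf ennreal_mult[symmetric])
  finally show ?thesis .
qed

text \<open>The thresholds are arbitrary Borel functions of the outer block of priorities, so
  product measures apply without any completion. Nonnegative integrals let Tonelli's theorem be used
  before integrability is known.\<close>

lemma (in prob_space) nn_integral_indep_inverse_probability_weights:
  fixes R :: "'i \<Rightarrow> 'a \<Rightarrow> real" and g :: "'i \<Rightarrow> ('i \<Rightarrow> real) \<Rightarrow> ereal"
  assumes indep: "indep_vars (\<lambda>_. borel) R I"
    and I: "finite I" and L: "L \<subseteq> I"
    and F: "\<And>i. i \<in> L \<Longrightarrow> F i = cdf (distr M borel (R i))"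
    and cont: "\<And>i. i \<in> L \<Longrightarrow> continuous_on UNIV (F i)"
    and g: "\<And>i. i \<in> L \<Longrightarrow> g i \<in> borel_measurable (\<Pi>\<^sub>M j\<in>I - L. borel)"
    and pos: "\<And>i. i \<in> L \<Longrightarrow> AE \<omega> in M. 0 < ext_cdf (F i) (g i (\<lambda>j\<in>I - L. R j \<omega>))"
  shows "(\<integral>\<^sup>+\<omega>. (\<Prod>i\<in>L. ennreal (of_bool (ereal (R i \<omega>) < g i (\<lambda>j\<in>I - L. R j \<omega>))
           / ext_cdf (F i) (g i (\<lambda>j\<in>I - L. R j \<omega>)))) \<partial>M) = 1"
\<comment> \<open>The characterisation of independence by a product law, used below for the inner
  block, requires a nonempty index set.\<close>
proof (cases "L = {}")
  case True
  then show ?thesis by (simp add: emeasure_space_1)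
next
  case False
  have finL: "finite L" using I L finite_subset by blast
  have R[measurable]: "random_variable borel (R i)" if "i \<in> I" for i
    using indep that unfolding indep_vars_def by auto
  define N where "N = (\<Pi>\<^sub>M j\<in>I - L. borel :: real measure)"
  define Q where "Q = distr M N (\<lambda>\<omega>. \<lambda>j\<in>I - L. R j \<omega>)"
  \<comment> \<open>The locale of product probability spaces wants a probability measure at every
    index; the point mass at 0 is a placeholder outside \<open>L\<close>.\<close>
  define D where "D i = (if i \<in> L then distr M borel (R i) else return borel 0)" for i
  define w where "w i t r = ennreal (of_bool (ereal r < t) / ext_cdf (F i) t)" for i t r
  have D: "real_distribution (D i)" for i
    using L unfolding D_def
    by (auto intro!: prob_space_distr R prob_space_return
        simp: real_distribution_def real_distribution_axioms_def)
  interpret D: product_prob_space D L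
    by (intro product_prob_spaceI real_distribution.axioms(1)[OF D])
  have sets_DL: "sets (PiM L D) = sets (\<Pi>\<^sub>M j\<in>L. borel)"
    by (intro sets_PiM_cong) (auto simp: D_def)
  have [measurable]: "F i \<in> borel_measurable borel" if "i \<in> L" for i
    using cont[OF that] by (rule borel_measurable_continuous_onI)
  note [measurable] = borel_measurable_ext_cdf
  have g'[measurable]: "g i \<in> borel_measurable N" if "i \<in> L" for i
    using g[OF that] by (simp add: N_def)
  have rv_out[measurable]: "(\<lambda>\<omega>. \<lambda>j\<in>I - L. R j \<omega>) \<in> measurable M N"
    unfolding N_def by (intro measurable_restrict R) auto
  \<comment> \<open>The blocks \<open>I - L\<close> and \<open>L\<close> are disjoint, so the
    arguments of the thresholds are independent of the priorities compared with them.\<close>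
  have indep2: "indep_var N (\<lambda>\<omega>. \<lambda>j\<in>I - L. R j \<omega>) (\<Pi>\<^sub>M j\<in>L. borel) (\<lambda>\<omega>. \<lambda>j\<in>L. R j \<omega>)"
    unfolding N_def using indep L by (intro indep_var_restrict) auto
  then have rv_in[measurable]: "(\<lambda>\<omega>. \<lambda>j\<in>L. R j \<omega>) \<in> measurable M (\<Pi>\<^sub>M j\<in>L. borel)"
    by (rule indep_var_rv2)
  \<comment> \<open>Independence within \<open>L\<close> makes the law of the inner block a product
    of marginals; with the independence of the blocks this gives \<open>joint\<close>, the product
    law behind the iterated integral.\<close>
  have "distr M (\<Pi>\<^sub>M j\<in>L. borel) (\<lambda>\<omega>. \<lambda>j\<in>L. R j \<omega>) = (\<Pi>\<^sub>M j\<in>L. distr M borel (R j))"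
    using L by (intro indep_vars_iff_distr_eq_PiM'[THEN iffD1, OF False _ indep_vars_subset[OF indep L]] R)
      auto
  also have "\<dots> = PiM L D"
    by (intro PiM_cong) (auto simp: D_def)
  finally have joint: "Q \<Otimes>\<^sub>M PiM L D
      = distr M (N \<Otimes>\<^sub>M (\<Pi>\<^sub>M j\<in>L. borel)) (\<lambda>\<omega>. (\<lambda>j\<in>I - L. R j \<omega>, \<lambda>j\<in>L. R j \<omega>))"
    using indep2 unfolding indep_var_distribution_eq Q_def by simp
  \<comment> \<open>Positivity depends on the sample point only through the outer block, so it
    passes to the law \<open>Q\<close>; since \<open>L\<close> is finite, one null set serves all
    its indices.\<close>
  have posQ: "AE s in Q. \<forall>i\<in>L. 0 < ext_cdf (F i) (g i s)"
    unfolding Q_def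
  proof (subst AE_distr_iff)
    show "{s \<in> space N. \<forall>i\<in>L. 0 < ext_cdf (F i) (g i s)} \<in> sets N"
      using finL by measurable
  qed (use pos finL in \<open>auto intro: AE_finite_allI\<close>)
  have w_meas: "(\<lambda>p. \<Prod>i\<in>L. w i (g i (fst p)) (snd p i))
      \<in> borel_measurable (N \<Otimes>\<^sub>M (\<Pi>\<^sub>M j\<in>L. borel))"
    unfolding w_def
  proof (rule borel_measurable_prod_ennreal)
    fix i assume i[measurable]: "i \<in> L"
    show "(\<lambda>p. ennreal (of_bool (ereal (snd p i) < g i (fst p)) / ext_cdf (F i) (g i (fst p))))
      \<in> borel_measurable (N \<Otimes>\<^sub>M (\<Pi>\<^sub>M j\<in>L. borel))"
      using i by measurable
  qed
  have "(\<integral>\<^sup>+\<omega>. (\<Prod>i\<in>L. w i (g i (\<lambda>j\<in>I - L. R j \<omega>)) (R i \<omega>)) \<partial>M)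
      = (\<integral>\<^sup>+p. (\<Prod>i\<in>L. w i (g i (fst p)) (snd p i)) \<partial>(Q \<Otimes>\<^sub>M PiM L D))"
    unfolding joint using w_meas by (subst nn_integral_distr) auto
  also have "\<dots> = (\<integral>\<^sup>+s. \<integral>\<^sup>+r. (\<Prod>i\<in>L. w i (g i s) (r i)) \<partial>PiM L D \<partial>Q)"
  proof -
    have "(\<lambda>p. \<Prod>i\<in>L. w i (g i (fst p)) (snd p i)) \<in> borel_measurable (Q \<Otimes>\<^sub>M PiM L D)"
      using w_meas unfolding joint by simp
    from D.P.nn_integral_fst[OF this] show ?thesis by simp
  qed
  also have "\<dots> = (\<integral>\<^sup>+s. 1 \<partial>Q)"
  proof (rule nn_integral_cong_AE)
    show "AE s in Q. (\<integral>\<^sup>+r. (\<Prod>i\<in>L. w i (g i s) (r i)) \<partial>PiM L D) = 1"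
      using posQ
    proof eventually_elim
      case (elim s)
      have "(\<integral>\<^sup>+r. (\<Prod>i\<in>L. w i (g i s) (r i)) \<partial>PiM L D)
          = (\<Prod>i\<in>L. \<integral>\<^sup>+r. w i (g i s) r \<partial>D i)"
        by (intro D.product_nn_integral_prod finL) (auto simp: w_def D_def)
      also have "\<dots> = (\<Prod>i\<in>L. 1)"
      proof (rule prod.cong)
        fix i assume i: "i \<in> L"
        interpret Di: real_distribution "D i" by (rule D)
        have Fi: "F i = cdf (D i)" using F i by (simp add: D_def)
        from elim i have "0 < ext_cdf (F i) (g i s)" by blast
        then show "(\<integral>\<^sup>+r. w i (g i s) r \<partial>D i) = 1"
          using Di.nn_integral_inverse_probability_weight[of "g i s"] cont[OF i]
          by (simp add: w_def Fi)
      qed simp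
      finally show ?case by simp
    qed
  qed
  also have "\<dots> = 1"
    using prob_space.emeasure_space_1[OF prob_space_distr[OF rv_out]] by (simp add: Q_def)
  finally show ?thesis by (simp add: w_def)
qed

text \<open>The recalibrated rules are measurable only for a completed law. They are replaced by
  Borel versions that agree almost surely, the product of weights is integrated for these, and the
  result is carried back over \<open>completion M\<close>.\<close>

lemma (in prob_space) has_bochner_integral_recalibrated_weight:
  fixes R :: "nat \<Rightarrow> 'a \<Rightarrow> real"
  assumes indep: "indep_vars (\<lambda>_. borel) R {1..n}" and L: "L \<subseteq> {1..n}"
    and F: "\<And>i. i \<in> L \<Longrightarrow> F i = cdf (distr M borel (R i))"
    and cont: "\<And>i. i \<in> L \<Longrightarrow> continuous_on UNIV (F i)"
    and meas: "\<And>i. i \<in> L \<Longrightarrow> recalibrated_rule_measurable M n V \<tau> R L i"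
    and pos: "\<And>i. i \<in> L \<Longrightarrow>
      AE \<omega> in M. 0 < ext_cdf (F i) (recalibrated_threshold n V \<tau> R \<omega> L i)"
  shows "has_bochner_integral (completion M)
    (\<lambda>\<omega>. \<Prod>i\<in>L. recalibrated_indicator n V \<tau> R \<omega> L i
       / ext_cdf (F i) (recalibrated_threshold n V \<tau> R \<omega> L i)) 1"
    (is "has_bochner_integral _ ?f _")
proof -
  let ?N = "\<Pi>\<^sub>M j\<in>{1..n} - L. borel :: real measure"
  let ?X = "\<lambda>\<omega>. \<lambda>j\<in>{1..n} - L. R j \<omega>"
  have finL: "finite L" using L finite_subset by blast
  have R[measurable]: "random_variable borel (R i)" if "i \<in> {1..n}" for i
    using indep that unfolding indep_vars_def by auto
  have X[measurable]: "?X \<in> measurable M ?N"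
    by (intro measurable_restrict R) auto
  \<comment> \<open>The Borel version agrees with the rule almost everywhere under the law of the
    outer block; pulled back along \<open>?X\<close>, this is almost sure equality of
    thresholds.\<close>
  have "\<forall>i\<in>L. \<exists>g'. g' \<in> borel_measurable ?N \<and>
      (AE \<omega> in M. recalibrated_threshold n V \<tau> R \<omega> L i = g' (?X \<omega>))"
  proof
    fix i assume i: "i \<in> L"
    obtain g' where "g' \<in> borel_measurable (distr M ?N ?X)"
      and eq: "AE s in distr M ?N ?X. recalibrated_rule n V \<tau> L i s = g' s"
      using completion_ex_borel_measurable_ereal
        [OF meas[OF i, unfolded recalibrated_rule_measurable_def]] by blast
    then show "\<exists>g'. g' \<in> borel_measurable ?N \<and>
        (AE \<omega> in M. recalibrated_threshold n V \<tau> R \<omega> L i = g' (?X \<omega>))"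
      using AE_distrD[OF X eq] by (auto simp: recalibrated_threshold_def)
  qed
  from bchoice[OF this] obtain g where g: "\<And>i. i \<in> L \<Longrightarrow> g i \<in> borel_measurable ?N"
    and "\<And>i. i \<in> L \<Longrightarrow> AE \<omega> in M. recalibrated_threshold n V \<tau> R \<omega> L i = g i (?X \<omega>)"
    by auto
  then have thr: "AE \<omega> in M. \<forall>i\<in>L. recalibrated_threshold n V \<tau> R \<omega> L i = g i (?X \<omega>)"
    using finL by (auto intro: AE_finite_allI)
  let ?w = "\<lambda>i \<omega>. of_bool (ereal (R i \<omega>) < g i (?X \<omega>)) / ext_cdf (F i) (g i (?X \<omega>))"
  \<comment> \<open>This holds at every point, also where the denominator is 0, so that
    \<open>ennreal\<close> commutes with the product pointwise.\<close>
  have w_nonneg: "0 \<le> ?w i \<omega>" if "i \<in> L" for i \<omega>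
  proof -
    interpret Ri: real_distribution "distr M borel (R i)"
      using L that by (intro real_distribution_distr R) auto
    show ?thesis using Ri.ext_cdf_nonneg F[OF that] by simp
  qed
  have w_meas: "?w i \<in> borel_measurable M" if "i \<in> L" for i
  proof -
    have [measurable]: "F i \<in> borel_measurable borel"
      using cont[OF that] by (rule borel_measurable_continuous_onI)
    note [measurable] = borel_measurable_ext_cdf g[OF that]
    have [measurable]: "random_variable borel (R i)"
      using R L that by auto
    show ?thesis by measurable
  qed
  have pos': "AE \<omega> in M. 0 < ext_cdf (F i) (g i (?X \<omega>))" if "i \<in> L" for i
    using pos[OF that] thr by eventually_elim (use that in auto)
  have prod_meas: "(\<lambda>\<omega>. \<Prod>i\<in>L. ?w i \<omega>) \<in> borel_measurable M"
    by (rule borel_measurable_prod) (rule w_meas)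
  have "(\<integral>\<^sup>+\<omega>. ennreal (\<Prod>i\<in>L. ?w i \<omega>) \<partial>M) = (\<integral>\<^sup>+\<omega>. (\<Prod>i\<in>L. ennreal (?w i \<omega>)) \<partial>M)"
    by (intro nn_integral_cong prod_ennreal[symmetric] w_nonneg)
  also have "\<dots> = 1"
    by (rule nn_integral_indep_inverse_probability_weights[OF indep finite_atLeastAtMost L])
      (blast intro: F cont g pos')+
  finally have "(\<integral>\<^sup>+\<omega>. ennreal (\<Prod>i\<in>L. ?w i \<omega>) \<partial>completion M) = ennreal 1"
    by (simp add: nn_integral_completion)
  \<comment> \<open>For a nonnegative measurable function, a finite nonnegative integral yields
    integrability together with the value.\<close>
  then have int: "has_bochner_integral (completion M) (\<lambda>\<omega>. \<Prod>i\<in>L. ?w i \<omega>) 1"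
    by (intro has_bochner_integral_nn_integral AE_I2 prod_nonneg measurable_completion prod_meas
        w_nonneg) simp_all
  have eq: "AE \<omega> in M. ?f \<omega> = (\<Prod>i\<in>L. ?w i \<omega>)"
    using thr by eventually_elim (simp add: recalibrated_indicator_def)
  have "?f \<in> borel_measurable (completion M)"
    using prod_meas eq by (rule AE_eq_borel_measurable_completion)
  from has_bochner_integral_cong_AE[OF this measurable_completion[OF prod_meas] AE_completion[OF eq]]
  show ?thesis using int by (rule iffD2)
qed

theorem theorem2:
  fixes M :: "'w measure" and n :: nat
    and x :: "nat \<Rightarrow> 'x"
    and R :: "nat \<Rightarrow> 'w \<Rightarrow> real" and F :: "nat \<Rightarrow> real \<Rightarrow> real"
    and V :: "(nat \<Rightarrow> real) set" and \<tau> :: "nat \<Rightarrow> (nat \<Rightarrow> real) \<Rightarrow> ereal"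
    and \<Lambda>\<^sub>0 :: "nat set set" and h :: "nat set \<Rightarrow> (nat \<Rightarrow> 'x) \<Rightarrow> real"
  assumes "prob_space M"
    and "prob_space.indep_vars M (\<lambda>_. borel) R {1..n}"
    and "\<And>i. i \<in> {1..n} \<Longrightarrow> F i = cdf (distr M borel (R i))"
    and "\<And>i. i \<in> {1..n} \<Longrightarrow> continuous_on UNIV (F i)"
    and "V \<subseteq> {1..n} \<rightarrow>\<^sub>E UNIV"
    and "AE \<omega> in M. (\<lambda>j\<in>{1..n}. R j \<omega>) \<in> V"
    and "\<Lambda>\<^sub>0 \<subseteq> Pow {1..n}"
    and "\<And>L i. L \<in> \<Lambda>\<^sub>0 \<Longrightarrow> i \<in> L \<Longrightarrow> recalibrated_rule_measurable M n V \<tau> R L i"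
    and "\<And>L i. L \<in> \<Lambda>\<^sub>0 \<Longrightarrow> i \<in> L \<Longrightarrow>
           AE \<omega> in M. 0 < ext_cdf (F i) (recalibrated_threshold n V \<tau> R \<omega> L i)"
  shows "integrable (completion M) (recalibrated_pseudo_HT n V \<tau> R \<Lambda>\<^sub>0 h x F) \<and>
         (\<integral>\<omega>. recalibrated_pseudo_HT n V \<tau> R \<Lambda>\<^sub>0 h x F \<omega> \<partial>completion M)
           = statistic \<Lambda>\<^sub>0 h x"
proof -
  interpret prob_space M by fact
  let ?W = "\<lambda>L \<omega>. \<Prod>i\<in>L. recalibrated_indicator n V \<tau> R \<omega> L i
    / ext_cdf (F i) (recalibrated_threshold n V \<tau> R \<omega> L i)"
  have "has_bochner_integral (completion M) (?W L) 1" if L: "L \<in> \<Lambda>\<^sub>0" for L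
  proof -
    have sub: "L \<subseteq> {1..n}" using L assms(7) by auto
    show ?thesis
    proof (rule has_bochner_integral_recalibrated_weight[OF assms(2) sub])
      fix i assume i: "i \<in> L"
      then have "i \<in> {1..n}" by (rule subsetD[OF sub])
      then show "F i = cdf (distr M borel (R i))" "continuous_on UNIV (F i)"
        by (rule assms(3), rule assms(4))
      show "recalibrated_rule_measurable M n V \<tau> R L i"
        using L i by (rule assms(8))
      show "AE \<omega> in M. 0 < ext_cdf (F i) (recalibrated_threshold n V \<tau> R \<omega> L i)"
        using L i by (rule assms(9))
    qed
  qed
  \<comment> \<open>Each \<open>L\<close> uses its own recalibrated thresholds, but linearity asks
    nothing about the joint law of the summands.\<close>
  then have "has_bochner_integral (completion M)
      (\<lambda>\<omega>. \<Sum>L\<in>\<Lambda>\<^sub>0. h L (restrict x L) * ?W L \<omega>) (\<Sum>L\<in>\<Lambda>\<^sub>0. h L (restrict x L) * 1)"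
    by (intro has_bochner_integral_sum has_bochner_integral_mult_right)
  moreover have "recalibrated_pseudo_HT n V \<tau> R \<Lambda>\<^sub>0 h x F
      = (\<lambda>\<omega>. \<Sum>L\<in>\<Lambda>\<^sub>0. h L (restrict x L) * ?W L \<omega>)"
    by (simp add: fun_eq_iff recalibrated_pseudo_HT_def pseudo_HT_def)
  ultimately show ?thesis
    by (simp add: has_bochner_integral_iff statistic_def)
qed

end
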